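(* Consider the two-step midpoint method for the initial value problem $u'(t)=f(u(t),t)$, $u(0)=u_0$, $t\in[0,T]$, given by the difference formula $$\tfrac12(u_{j+1}-u_{j-1})=\tau f_j,\qquad j=1,\dots,N-1 .$$ This defines a two-step linear multistep method with $(k_1,k_2)=(1,1)$. Furthermore, the $(1,1)$-absolute stability region of this method is $$R_{1,1}=\{q\in\mathbb C:\ q\notin[-\mathrm i,\mathrm i]\},$$ where $[-\mathrm i,\mathrm i]$ denotes the closed line segment $\{\mathrm i s: s\in[-1,1]\}$ in $\mathbb C$.
   Context: Here $\tau=T/N$, $t_r=r\tau$, $u_r\approx u(t_r)$, $f_r=f(u_r,t_r)$. A $k$-step linear multistep formula $\sum_{r=0}^k\alpha_r u_{r+j}=\tau\sum_{r=0}^k\beta_r f_{r+j}$, used as a boundary value method with $k_1$ initial and $k_2=k-k_1$ final conditions, has characteristic polynomials $\rho(z)=\sum_{j=0}^k\alpha_j z^j$ and $\sigma(z)=\sum_{j=0}^k\beta_j z^j$. For the midpoint formula, $k=2$, $\rho(z)=\frac12(z^2-1)$, $\sigma(z)=z$. A polynomial of degree $k=k_1+k_2$ is an $S_{k_1,k_2}$-polynomial if its roots (counted with multiplicity) can be ordered so that $|z_1|\le\cdots\le|z_{k_1}|<1<|z_{k_1+1}|\le\cdots\le|z_k|$. For $q\in\mathbb C$, the method is $(k_1,k_2)$-absolutely stable at $q$ if $\pi(z,q)=\rho(z)-q\sigma(z)$ (as a polynomial in $z$) is an $S_{k_1,k_2}$-polynomial. The $(k_1,k_2)$-absolute stability region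 is $R_{k_1,k_2}=\{q\in\mathbb C:\ \pi(\cdot,q)\text{ is an }S_{k_1,k_2}\text{-polynomial}\}$. *)

theory Defs
  imports "HOL-Analysis.Analysis" "HOL-Computational_Algebra.Computational_Algebra"
begin

text \<open>A \<open>k\<close>-step formula has coefficients \<open>\<alpha> 0, \<dots>, \<alpha> k\<close> and \<open>\<beta> 0, \<dots>, \<beta> k\<close>; values at larger
  indices are never used. The two conditions are the usual ones saying that the formula really
  involves both its last value and its first value.\<close>

definition multistep_coeffs :: "nat \<Rightarrow> (nat \<Rightarrow> real) \<Rightarrow> (nat \<Rightarrow> real) \<Rightarrow> bool" where
  "multistep_coeffs k \<alpha> \<beta> \<longleftrightarrow> \<alpha> k \<noteq> 0 \<and> (\<alpha> 0 \<noteq> 0 \<or> \<beta> 0 \<noteq> 0)"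

definition time_step :: "real \<Rightarrow> nat \<Rightarrow> real" where
  "time_step T N = T / real N"

definition grid_time :: "real \<Rightarrow> nat \<Rightarrow> nat \<Rightarrow> real" where
  "grid_time T N r = real r * time_step T N"

definition multistep_equation ::
  "nat \<Rightarrow> (nat \<Rightarrow> real) \<Rightarrow> (nat \<Rightarrow> real) \<Rightarrow> real \<Rightarrow> nat
    \<Rightarrow> ('a::real_vector \<Rightarrow> real \<Rightarrow> 'a) \<Rightarrow> (nat \<Rightarrow> 'a) \<Rightarrow> nat \<Rightarrow> bool" where
  "multistep_equation k \<alpha> \<beta> T N f u j \<longleftrightarrow>
     (\<Sum>r=0..k. \<alpha> r *\<^sub>R u (r + j)) =
     time_step T N *\<^sub>R (\<Sum>r=0..k. \<beta> r *\<^sub>R f (u (r + j)) (grid_time T N (r + j)))"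

text \<open>The formula used as a boundary value method on the unknowns \<open>u 0, \<dots>, u N\<close>: it is imposed
  wherever all its indices lie in \<open>{0..N}\<close>, the first \<open>k\<^sub>1\<close> unknowns are fixed by initial conditions
  and the last \<open>k\<^sub>2\<close> unknowns by final conditions. The right-hand sides \<open>ini\<close> and \<open>fin\<close> may depend on
  the grid function, so that both prescribed values (constant in \<open>u\<close>) and auxiliary closing
  formulas such as backward Euler in the last step are covered.\<close>

definition boundary_value_method ::
  "nat \<Rightarrow> nat \<Rightarrow> (nat \<Rightarrow> real) \<Rightarrow> (nat \<Rightarrow> real) \<Rightarrow> real \<Rightarrow> nat
    \<Rightarrow> ('a::real_vector \<Rightarrow> real \<Rightarrow> 'a)
    \<Rightarrow> ((nat \<Rightarrow> 'a) \<Rightarrow> nat \<Rightarrow> 'a) \<Rightarrow> ((nat \<Rightarrow> 'a) \<Rightarrow> nat \<Rightarrow> 'a) \<Rightarrow> (nat \<Rightarrow> 'a) \<Rightarrow> bool" where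
  "boundary_value_method k\<^sub>1 k\<^sub>2 \<alpha> \<beta> T N f ini fin u \<longleftrightarrow>
     (\<forall>i<k\<^sub>1. u i = ini u i) \<and>
     (\<forall>j. j + (k\<^sub>1 + k\<^sub>2) \<le> N \<longrightarrow> multistep_equation (k\<^sub>1 + k\<^sub>2) \<alpha> \<beta> T N f u j) \<and>
     (\<forall>i. N < i + k\<^sub>2 \<and> i \<le> N \<longrightarrow> u i = fin u i)"

definition char_poly :: "nat \<Rightarrow> (nat \<Rightarrow> real) \<Rightarrow> complex poly" where
  "char_poly k c = (\<Sum>j=0..k. monom (complex_of_real (c j)) j)"

definition stability_poly ::
  "nat \<Rightarrow> (nat \<Rightarrow> real) \<Rightarrow> (nat \<Rightarrow> real) \<Rightarrow> complex \<Rightarrow> complex poly" where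
  "stability_poly k \<alpha> \<beta> q = char_poly k \<alpha> - smult q (char_poly k \<beta>)"

text \<open>The condition \<open>p \<noteq> 0\<close> only matters for \<open>k\<^sub>1 = k\<^sub>2 = 0\<close>, as \<open>degree 0 = 0\<close>. The list \<open>zs\<close> is
  indexed from \<open>0\<close>.\<close>

definition S_polynomial :: "nat \<Rightarrow> nat \<Rightarrow> complex poly \<Rightarrow> bool" where
  "S_polynomial k\<^sub>1 k\<^sub>2 p \<longleftrightarrow>
     p \<noteq> 0 \<and> degree p = k\<^sub>1 + k\<^sub>2 \<and>
     (\<exists>zs. mset zs = proots p \<and> sorted (map cmod zs) \<and>
        (\<forall>i<k\<^sub>1. cmod (zs ! i) < 1) \<and>
        (\<forall>i. k\<^sub>1 \<le> i \<and> i < k\<^sub>1 + k\<^sub>2 \<longrightarrow> 1 < cmod (zs ! i)))"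

definition absolutely_stable ::
  "nat \<Rightarrow> nat \<Rightarrow> (nat \<Rightarrow> real) \<Rightarrow> (nat \<Rightarrow> real) \<Rightarrow> complex \<Rightarrow> bool" where
  "absolutely_stable k\<^sub>1 k\<^sub>2 \<alpha> \<beta> q \<longleftrightarrow> S_polynomial k\<^sub>1 k\<^sub>2 (stability_poly (k\<^sub>1 + k\<^sub>2) \<alpha> \<beta> q)"

definition stability_region ::
  "nat \<Rightarrow> nat \<Rightarrow> (nat \<Rightarrow> real) \<Rightarrow> (nat \<Rightarrow> real) \<Rightarrow> complex set" where
  "stability_region k\<^sub>1 k\<^sub>2 \<alpha> \<beta> = {q. absolutely_stable k\<^sub>1 k\<^sub>2 \<alpha> \<beta> q}"

definition midpoint_equation ::
  "real \<Rightarrow> nat \<Rightarrow> ('a::real_vector \<Rightarrow> real \<Rightarrow> 'a) \<Rightarrow> (nat \<Rightarrow> 'a) \<Rightarrow> nat \<Rightarrow> bool" where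
  "midpoint_equation T N f u j \<longleftrightarrow>
     (1/2) *\<^sub>R (u (j + 1) - u (j - 1)) = time_step T N *\<^sub>R f (u j) (grid_time T N j)"

definition midpoint_alpha :: "nat \<Rightarrow> real" where
  "midpoint_alpha = (\<lambda>_. 0)(0 := -1/2, 2 := 1/2)"

definition midpoint_beta :: "nat \<Rightarrow> real" where
  "midpoint_beta = (\<lambda>_. 0)(1 := 1)"

lemma char_poly_midpoint:
  "char_poly 2 midpoint_alpha = smult (1/2) ([:0, 1:]\<^sup>2 - 1)"
  "char_poly 2 midpoint_beta = [:0, 1:]"
  by (simp_all add: char_poly_def midpoint_alpha_def midpoint_beta_def numeral_2_eq_2
      monom_Suc monom_0 one_pCons)

end

theory Submission
  imports Defs
begin

text \<open>The stability polynomial of the midpoint rule is \<open>(z\<^sup>2 - 2 q z - 1) / 2\<close>. The product of its two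
  roots is \<open>-1\<close>, so they are \<open>w\<close> and \<open>-1/w\<close>: one lies strictly inside and the other strictly outside
  the unit circle, unless both lie on it. Stability at \<open>q\<close> thus fails exactly when \<open>q = (w - 1/w) / 2\<close>
  for some \<open>w\<close> on the unit circle. There \<open>1/w\<close> is the conjugate of \<open>w\<close>, so that \<open>q = \<i> Im w\<close>, and
  \<open>Im w\<close> takes every value in \<open>[-1, 1]\<close>; this is \<open>unit_root_iff_segment\<close>.

  The claim about the scheme is a shift of index: the two-step formula started at \<open>j\<close> is the midpoint
  formula centred at \<open>j + 1\<close>.\<close>

lemma multistep_equation_midpoint_iff:
  "multistep_equation 2 midpoint_alpha midpoint_beta T N f u j \<longleftrightarrow>
   midpoint_equation T N f u (Suc j)"
  by (simp add: multistep_equation_def midpoint_equation_def midpoint_alpha_def midpoint_beta_def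
      numeral_2_eq_2 algebra_simps)

lemma boundary_value_method_midpoint_iff:
  assumes "0 < N"
  shows "boundary_value_method 1 1 midpoint_alpha midpoint_beta T N f (\<lambda>_ _. u\<^sub>0) fin u \<longleftrightarrow>
    u 0 = u\<^sub>0 \<and> (\<forall>j\<in>{1..N-1}. midpoint_equation T N f u j) \<and> u N = fin u N"
proof -
  have "(\<forall>j. j + 2 \<le> N \<longrightarrow> midpoint_equation T N f u (Suc j)) \<longleftrightarrow>
      (\<forall>j\<in>{1..N-1}. midpoint_equation T N f u j)" (is "?L \<longleftrightarrow> ?R")
  proof
    assume L: ?L
    show ?R
    proof
      fix j assume "j \<in> {1..N-1}"
      then show "midpoint_equation T N f u j"
        using L[rule_format, of "j - 1"] by auto
    qed
  next
    assume ?R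
    then show ?L by auto
  qed
  moreover have "(\<forall>i. N < i + 1 \<and> i \<le> N \<longrightarrow> u i = fin u i) \<longleftrightarrow> u N = fin u N"
    by (auto simp: less_Suc_eq_le dest: le_antisym)
  ultimately show ?thesis
    unfolding boundary_value_method_def one_add_one multistep_equation_midpoint_iff by auto
qed

lemma S_polynomial_1_1_iff:
  assumes "degree p = 2" and roots: "proots p = {#a, b#}"
  shows "S_polynomial 1 1 p \<longleftrightarrow> cmod a < 1 \<and> 1 < cmod b \<or> cmod b < 1 \<and> 1 < cmod a"
proof -
  have "mset zs = {#a, b#} \<longleftrightarrow> zs = [a, b] \<or> zs = [b, a]" for zs
  proof
    assume m: "mset zs = {#a, b#}"
    then have "length zs = 2" by (simp flip: size_mset)
    then obtain c d where "zs = [c, d]"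
      by (auto simp: numeral_2_eq_2 length_Suc_conv)
    then show "zs = [a, b] \<or> zs = [b, a]" using m by (auto simp: add_eq_conv_ex)
  qed auto
  moreover have "(\<forall>i. 1 \<le> i \<and> i < 1 + 1 \<longrightarrow> P i) \<longleftrightarrow> P 1" for P :: "nat \<Rightarrow> bool"
    by (auto simp: less_Suc_eq_le dest: le_antisym)
  moreover have "p \<noteq> 0" using assms(1) by auto
  ultimately have "S_polynomial 1 1 p \<longleftrightarrow>
      (\<exists>zs. (zs = [a, b] \<or> zs = [b, a]) \<and> sorted (map cmod zs) \<and>
        cmod (zs ! 0) < 1 \<and> 1 < cmod (zs ! 1))"
    unfolding S_polynomial_def roots assms(1) less_one by simp
  also have "\<dots> \<longleftrightarrow> cmod a < 1 \<and> 1 < cmod b \<or> cmod b < 1 \<and> 1 < cmod a"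
    by auto
  finally show ?thesis .
qed

text \<open>Since the product of the roots is \<open>-1\<close>, either root \<open>w\<close> determines the whole factorization.\<close>

lemma midpoint_stability_poly_factor:
  assumes "w \<noteq> 0" and "2 * q = w - 1 / w"
  shows "stability_poly 2 midpoint_alpha midpoint_beta q =
    smult (1/2) ([:- w, 1:] * [:- (- 1 / w), 1:])"
proof -
  have "q * 2 = w - 1 / w" using assms(2) by (simp only: mult.commute)
  with assms(1) show ?thesis
    unfolding stability_poly_def char_poly_midpoint
    by (simp add: power2_eq_square one_pCons field_simps)
qed

lemma ex_midpoint_root: "\<exists>w::complex. w \<noteq> 0 \<and> 2 * q = w - 1 / w"
proof -
  define w where "w = q + csqrt (q\<^sup>2 + 1)"
  have *: "w * (w - 2 * q) = 1"
  proof -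
    have "w * (w - 2 * q) = (csqrt (q\<^sup>2 + 1))\<^sup>2 - q\<^sup>2"
      unfolding w_def by (simp add: algebra_simps power2_eq_square)
    then show ?thesis by simp
  qed
  then have "w \<noteq> 0" by auto
  moreover from this * have "2 * q = w - 1 / w" by (simp add: field_simps)
  ultimately show ?thesis by blast
qed

lemma S_polynomial_midpoint_iff:
  assumes "w \<noteq> 0" and "2 * q = w - 1 / w"
  shows "S_polynomial 1 1 (stability_poly 2 midpoint_alpha midpoint_beta q) \<longleftrightarrow> cmod w \<noteq> 1"
proof -
  let ?p = "smult (1/2) ([:- w, 1:] * [:- (- 1 / w), 1:])"
  have "degree ?p = 2" by (simp add: degree_mult_eq)
  moreover have "proots ?p = proots [:- w, 1:] + proots [:- (- 1 / w), 1:]"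
    by (subst proots_smult, simp, subst proots_mult) auto
  then have "proots ?p = {#w, - 1 / w#}"
    by (simp only: proots_linear_factor) simp
  ultimately have "S_polynomial 1 1 ?p \<longleftrightarrow>
      cmod w < 1 \<and> 1 < cmod (- 1 / w) \<or> cmod (- 1 / w) < 1 \<and> 1 < cmod w"
    by (rule S_polynomial_1_1_iff)
  also have "\<dots> \<longleftrightarrow> cmod w \<noteq> 1"
    using assms(1) by (auto simp: norm_divide field_simps)
  finally show ?thesis
    by (simp only: midpoint_stability_poly_factor[OF assms])
qed

text \<open>On the unit circle \<open>w - 1/w = w - cnj w = 2 \<i> Im w\<close>. Conversely, for \<open>q = \<i> s\<close> the equation
  \<open>2 q = w - 1/w\<close> says \<open>(w - \<i> s)\<^sup>2 = 1 - s\<^sup>2\<close>, whose right-hand side is nonnegative; hence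
  \<open>w = \<plusminus>sqrt (1 - s\<^sup>2) + \<i> s\<close>, a point of the unit circle.\<close>

lemma unit_root_iff_segment:
  fixes w q :: complex
  assumes "w \<noteq> 0" and q: "2 * q = w - 1 / w"
  shows "cmod w = 1 \<longleftrightarrow> (\<exists>s\<in>{-1..1}. q = \<i> * complex_of_real s)"
proof
  assume w: "cmod w = 1"
  then have "w * cnj w = 1"
    using complex_norm_square[of w] by simp
  then have "1 / w = cnj w" using assms(1) nonzero_mult_div_cancel_left[of w "cnj w"] by simp
  with q have "q = \<i> * complex_of_real (Im w)"
    by (simp add: complex_eq_iff)
  moreover have "Im w \<in> {-1..1}"
    using abs_Im_le_cmod[of w] w by auto
  ultimately show "\<exists>s\<in>{-1..1}. q = \<i> * complex_of_real s" by blast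
next
  assume "\<exists>s\<in>{-1..1}. q = \<i> * complex_of_real s"
  then obtain s where s: "-1 \<le> s" "s \<le> 1" and qs: "q = \<i> * complex_of_real s" by auto
  have s2: "s\<^sup>2 \<le> 1" using s by (simp add: abs_square_le_1 abs_le_iff)
  define r where "r = sqrt (1 - s\<^sup>2)"
  have r2: "r\<^sup>2 = 1 - s\<^sup>2" using s2 by (simp add: r_def)
  have "w\<^sup>2 - 2 * q * w - 1 = 0"
    using assms(1) q by (simp add: field_simps power2_eq_square)
  then have "(w - \<i> * complex_of_real s)\<^sup>2 = complex_of_real (1 - s\<^sup>2)"
    by (simp add: qs power2_eq_square algebra_simps)
  then have "(w - \<i> * complex_of_real s)\<^sup>2 = (complex_of_real r)\<^sup>2"
    by (simp only: r2[symmetric] of_real_power)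
  then have "w - \<i> * complex_of_real s = complex_of_real r \<or>
      w - \<i> * complex_of_real s = - complex_of_real r"
    by (simp only: power2_eq_iff)
  then have "(Re w)\<^sup>2 = r\<^sup>2" "Im w = s"
    by (auto simp: complex_eq_iff)
  then show "cmod w = 1" by (simp add: cmod_def r2)
qed

lemma stability_region_midpoint:
  "stability_region 1 1 midpoint_alpha midpoint_beta =
    {q. q \<notin> {\<i> * complex_of_real s | s. s \<in> {-1..1}}}"
proof -
  have "absolutely_stable 1 1 midpoint_alpha midpoint_beta q \<longleftrightarrow>
      \<not> (\<exists>s\<in>{-1..1}. q = \<i> * complex_of_real s)" for q
  proof -
    obtain w where w: "w \<noteq> 0" "2 * q = w - 1 / w" using ex_midpoint_root by blast
    show ?thesis
      unfolding absolutely_stable_def one_add_one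
      using S_polynomial_midpoint_iff[OF w] unit_root_iff_segment[OF w] by blast
  qed
  then show ?thesis unfolding stability_region_def by blast
qed

theorem theorem4p1:
  shows "multistep_coeffs 2 midpoint_alpha midpoint_beta \<and>
    (\<forall>(T::real) (N::nat) (f :: 'a::real_vector \<Rightarrow> real \<Rightarrow> 'a) u\<^sub>0 fin u. 0 < T \<and> 0 < N \<longrightarrow>
       (u 0 = u\<^sub>0 \<and> (\<forall>j\<in>{1..N-1}. midpoint_equation T N f u j) \<and> u N = fin u N
        \<longleftrightarrow> boundary_value_method 1 1 midpoint_alpha midpoint_beta T N f (\<lambda>_ _. u\<^sub>0) fin u)) \<and>
    stability_region 1 1 midpoint_alpha midpoint_beta =
      {q. q \<notin> {\<i> * complex_of_real s | s. s \<in> {-1..1}}}"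
proof (intro conjI)
  show "multistep_coeffs 2 midpoint_alpha midpoint_beta"
    by (simp add: multistep_coeffs_def midpoint_alpha_def)
  show "\<forall>(T::real) (N::nat) (f :: 'a \<Rightarrow> real \<Rightarrow> 'a) u\<^sub>0 fin u. 0 < T \<and> 0 < N \<longrightarrow>
       (u 0 = u\<^sub>0 \<and> (\<forall>j\<in>{1..N-1}. midpoint_equation T N f u j) \<and> u N = fin u N
        \<longleftrightarrow> boundary_value_method 1 1 midpoint_alpha midpoint_beta T N f (\<lambda>_ _. u\<^sub>0) fin u)"
    by (intro allI impI) (rule boundary_value_method_midpoint_iff[symmetric], elim conjE)
qed (rule stability_region_midpoint)

end
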